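(* Let $A \in \mathbb{R}^{n\times n}$ be a square non-singular matrix ($n \ge 1$), let $\gamma = \|A\|$ be its spectral norm, and let $\eta \in \mathbb{R}$. Consider the OGDA dynamics $$\mathbf{x}_{t+2} = \mathbf{x}_{t+1} - 2\eta A \mathbf{y}_{t+1} + \eta A \mathbf{y}_t, \qquad \mathbf{y}_{t+2} = \mathbf{y}_{t+1} + 2\eta A^T \mathbf{x}_{t+1} - \eta A^T \mathbf{x}_t \qquad (t \ge 0),$$ with initial state $\mathbf{x}_0,\mathbf{x}_1,\mathbf{y}_0,\mathbf{y}_1 \in \mathbb{R}^n$. (i) If $|\eta| < \frac{1}{\sqrt{3}\,\gamma}$, then for every initial state the sequence $(\mathbf{x}_t,\mathbf{y}_t)$ converges as $t\to\infty$. (ii) If $|\eta| \ge \frac{1}{\sqrt{3}\,\gamma}$, then the dynamics are unstable, i.e. there exists an initial state for which the sequence $(\mathbf{x}_t,\mathbf{y}_t)$ does not converge.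
   Context: OGDA (Optimistic Gradient Descent/Ascent) is applied to the unconstrained bilinear zero-sum game with objective $f(\mathbf{x},\mathbf{y}) = \mathbf{x}^T A \mathbf{y}$, where $\mathbf{x}$ is the minimizing and $\mathbf{y}$ the maximizing variable. The learning rate $\eta$ is allowed to be negative. The spectral norm $\|S\|$ is the square root of the largest eigenvalue of $S^TS$. "Converges" means that both strategy sequences have limits in $\mathbb{R}^n$. *)

theory Defs
  imports "HOL-Analysis.Analysis"
begin

definition matrix_eigenvalue :: "real^'n^'n \<Rightarrow> real \<Rightarrow> bool" where
  "matrix_eigenvalue M l \<longleftrightarrow> (\<exists>v. v \<noteq> 0 \<and> M *v v = l *\<^sub>R v)"

text \<open>
  The matrix \<open>transpose S ** S\<close> is symmetric, so all its complex eigenvalues are real and they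
  form a finite nonempty set; hence \<open>Max\<close> is applied within its intended domain.
\<close>

definition spectral_norm :: "real^'n^'n \<Rightarrow> real" where
  "spectral_norm S = sqrt (Max {l. matrix_eigenvalue (transpose S ** S) l})"

text \<open>
  The OGDA trajectory for the objective \<open>x \<bullet> (A *v y)\<close>, as a function of the
  initial state \<open>x0 x1 y0 y1\<close>.
\<close>

fun ogda_x :: "real^'n^'n \<Rightarrow> real \<Rightarrow> real^'n \<Rightarrow> real^'n \<Rightarrow> real^'n \<Rightarrow> real^'n \<Rightarrow> nat \<Rightarrow> real^'n"
  and ogda_y :: "real^'n^'n \<Rightarrow> real \<Rightarrow> real^'n \<Rightarrow> real^'n \<Rightarrow> real^'n \<Rightarrow> real^'n \<Rightarrow> nat \<Rightarrow> real^'n"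
where
  "ogda_x A \<eta> x0 x1 y0 y1 0 = x0"
| "ogda_x A \<eta> x0 x1 y0 y1 (Suc 0) = x1"
| "ogda_x A \<eta> x0 x1 y0 y1 (Suc (Suc t)) =
     ogda_x A \<eta> x0 x1 y0 y1 (Suc t)
     - (2 * \<eta>) *\<^sub>R (A *v ogda_y A \<eta> x0 x1 y0 y1 (Suc t))
     + \<eta> *\<^sub>R (A *v ogda_y A \<eta> x0 x1 y0 y1 t)"
| "ogda_y A \<eta> x0 x1 y0 y1 0 = y0"
| "ogda_y A \<eta> x0 x1 y0 y1 (Suc 0) = y1"
| "ogda_y A \<eta> x0 x1 y0 y1 (Suc (Suc t)) =
     ogda_y A \<eta> x0 x1 y0 y1 (Suc t)
     + (2 * \<eta>) *\<^sub>R (transpose A *v ogda_x A \<eta> x0 x1 y0 y1 (Suc t))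
     - \<eta> *\<^sub>R (transpose A *v ogda_x A \<eta> x0 x1 y0 y1 t)"

definition ogda_converges ::
  "real^'n^'n \<Rightarrow> real \<Rightarrow> real^'n \<Rightarrow> real^'n \<Rightarrow> real^'n \<Rightarrow> real^'n \<Rightarrow> bool" where
  "ogda_converges A \<eta> x0 x1 y0 y1 \<longleftrightarrow>
     convergent (ogda_x A \<eta> x0 x1 y0 y1) \<and> convergent (ogda_y A \<eta> x0 x1 y0 y1)"

end

theory Submission
  imports Defs
begin

text \<open>
  On pairs \<open>z = (x, y)\<close> the dynamics read \<open>z'' = z' + 2 K z' - K z\<close>, where
  \<open>K (x, y) = (- \<eta> A y, \<eta> A\<^sup>T x)\<close> is skew-symmetric and plays the role of \<open>\<i> s\<close> in the
  scalar recurrence with characteristic polynomial \<open>\<lambda>\<^sup>2 - (1 + 2 \<i> s) \<lambda> + \<i> s\<close>.  The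
  Schur--Cohn form of this polynomial has determinant \<open>s\<^sup>2 (1 - 3 s\<^sup>2)\<close>; with \<open>K\<close> substituted
  for \<open>\<i> s\<close> it becomes a Lyapunov function, which yields convergence to 0 without
  diagonalising \<open>A\<close>.  For instability, the top singular vectors of \<open>A\<close> span an invariant
  plane on which the dynamics are the scalar recurrence with \<open>s = \<eta> \<gamma>\<close>, and this has a
  characteristic root \<open>\<lambda> \<noteq> 1\<close> with \<open>|\<lambda>| \<ge> 1\<close>.
\<close>

section \<open>Convergence of skew recurrences\<close>

lemma skew_recurrence_tendsto_0:
  fixes K :: "'a::euclidean_space \<Rightarrow> 'a" and z :: "nat \<Rightarrow> 'a"
  assumes lin: "linear K"
    and skew: "\<And>a b. inner (K a) b = - inner a (K b)"
    and inj: "inj K"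
    and bound: "\<And>a. norm (K a) \<le> s * norm a"
    and s: "0 \<le> s" "3 * s\<^sup>2 < 1"
    and rec: "\<And>t. z (Suc (Suc t)) = z (Suc t) + 2 *\<^sub>R K (z (Suc t)) - K (z t)"
  shows "z \<longlonglongrightarrow> 0"
proof -
  note lin_simps = linear_add[OF lin] linear_diff[OF lin] linear_scale[OF lin] linear_neg[OF lin]
  have bound2: "(norm (K a))\<^sup>2 \<le> s\<^sup>2 * (norm a)\<^sup>2" for a
    using power_mono[OF bound[of a], of 2] by (simp add: power_mult_distrib)
  have skew0: "inner a (K a) = 0" "inner a (K (K (K a))) = 0" for a
    using skew[of a a] skew[of "K a" "K a"] skew[of a "K (K a)"] skew[of "K (K a)" a]
    by (simp_all add: inner_commute)
  text \<open>With \<open>a = 1 + K\<^sup>2\<close>, \<open>b = - 1 - 2 K\<^sup>2 - K\<close> and its adjoint \<open>b'\<close>, the Schur--Cohn form is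
    \<open>\<langle>a w, w\<rangle> + \<langle>a u, u\<rangle> + 2 \<langle>w, b u\<rangle>\<close>.  The Lyapunov function \<open>W\<close> is this form multiplied
    by \<open>a\<close>, so that completing the square gives
    \<open>|a w + b u|\<^sup>2 + \<langle>(a\<^sup>2 - b b') u, u\<rangle>\<close>; and \<open>g = a u + b' w\<close> measures its decrease.\<close>
  define g where "g w u = u + K (K u) - w - 2 *\<^sub>R K (K w) + K w" for w u
  define W where "W w u = (norm (w + K (K w) - u - 2 *\<^sub>R K (K u) - K u))\<^sup>2
      + (norm (K u))\<^sup>2 - 3 * (norm (K (K u)))\<^sup>2" for w u
  \<comment> \<open>The same form with the square completed in \<open>u\<close> instead of
    \<open>w\<close>. The remainder operator \<open>a\<^sup>2 - b b'\<close> is the same in both,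
    because polynomials in \<open>K\<close> commute.\<close>
  have sym: "(norm (w + K (K w) - u - 2 *\<^sub>R K (K u) - K u))\<^sup>2
        + (norm (K u))\<^sup>2 - 3 * (norm (K (K u)))\<^sup>2
      = (norm (g w u))\<^sup>2 + (norm (K w))\<^sup>2 - 3 * (norm (K (K w)))\<^sup>2" for w u
  proof -
    have swap: "inner w (K x) = - inner (K w) x" for w x
      by (simp add: skew)
    have c: "inner w (K u) = - inner u (K w)" "inner w (K (K u)) = inner u (K (K w))"
      "inner w (K (K (K u))) = - inner u (K (K (K w)))"
      "inner w (K (K (K (K u)))) = inner u (K (K (K (K w))))" "inner w u = inner u w"
      using swap[of w u] swap[of w "K u"] swap[of "K w" u] swap[of w "K (K u)"] swap[of "K w" "K u"]
        swap[of "K (K w)" u] swap[of w "K (K (K u))"] swap[of "K w" "K (K u)"]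
        swap[of "K (K w)" "K u"] swap[of "K (K (K w))" u]
      by (simp_all only: inner_commute[of u] minus_minus)
    show ?thesis
      unfolding g_def power2_norm_eq_inner
      by (simp add: inner_simps skew skew0 c algebra_simps)
  qed
  have dec: "W w u - W (w + 2 *\<^sub>R K w - K u) w = (norm (g w u))\<^sup>2 - (norm (K (g w u)))\<^sup>2" for w u
  proof -
    \<comment> \<open>One step of the recurrence turns \<open>a w + b u\<close> into
      \<open>- K (g w u)\<close>. The remainder in \<open>w\<close> then agrees with the one in
      \<open>sym\<close> and cancels.\<close>
    have "(w + 2 *\<^sub>R K w - K u) + K (K (w + 2 *\<^sub>R K w - K u)) - w - 2 *\<^sub>R K (K w) - K w = - K (g w u)"
      by (simp add: g_def lin_simps scaleR_2 algebra_simps)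
    then show ?thesis
      unfolding W_def sym[of w u] by simp
  qed
  have sle: "s\<^sup>2 * x \<le> x / 3" if "0 \<le> x" for x
    using mult_right_mono[of "s\<^sup>2" "1/3" x] s that by simp
  have W0: "0 \<le> W w u" for w u
  proof -
    have "3 * (norm (K (K u)))\<^sup>2 \<le> (norm (K u))\<^sup>2"
      using bound2[of "K u"] sle[of "(norm (K u))\<^sup>2"] by simp
    then show ?thesis
      unfolding W_def by (simp add: add_increasing)
  qed
  define v where "v t = W (z (Suc t)) (z t)" for t
  define h where "h t = g (z (Suc t)) (z t)" for t
  have v_dec: "(norm (h t))\<^sup>2 \<le> 3 / 2 * (v t - v (Suc t))" for t
  proof -
    have "v t - v (Suc t) = (norm (h t))\<^sup>2 - (norm (K (h t)))\<^sup>2"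
      unfolding v_def h_def rec by (rule dec)
    \<comment> \<open>\<open>K\<close> keeps at most a third of the squared norm, so
      \<open>v\<close> drops by at least two thirds of it: hence the factor 3/2.\<close>
    moreover have "(norm (K (h t)))\<^sup>2 \<le> (norm (h t))\<^sup>2 / 3"
      using bound2 sle[OF zero_le_power2] by (rule order_trans)
    ultimately show ?thesis
      by simp
  qed
  have "decseq v"
    unfolding decseq_Suc_iff
  proof
    fix t
    show "v (Suc t) \<le> v t"
      using order_trans[OF zero_le_power2 v_dec[of t]] by simp
  qed
  moreover have "\<forall>t. 0 \<le> v t"
    using W0 by (simp add: v_def)
  ultimately obtain L where L: "v \<longlonglongrightarrow> L"
    using decseq_convergent by blast
  have lim: "(\<lambda>t. 3 / 2 * (v t - v (Suc t))) \<longlonglongrightarrow> 3 / 2 * (L - L)"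
    by (intro tendsto_intros L LIMSEQ_Suc)
  have "(\<lambda>t. (norm (h t))\<^sup>2) \<longlonglongrightarrow> 0"
  proof (rule Lim_null_comparison)
    show "\<forall>\<^sub>F t in sequentially. norm ((norm (h t))\<^sup>2) \<le> 3 / 2 * (v t - v (Suc t))"
      unfolding real_norm_def abs_power2 by (rule always_eventually) (rule allI, rule v_dec)
    show "(\<lambda>t. 3 / 2 * (v t - v (Suc t))) \<longlonglongrightarrow> 0"
      using lim by simp
  qed
  then have h0: "h \<longlonglongrightarrow> 0"
    using tendsto_real_sqrt[of "\<lambda>t. (norm (h t))\<^sup>2" 0 sequentially]
    by (simp add: tendsto_norm_zero_iff)
  have K0: "(\<lambda>t. K (f t)) \<longlonglongrightarrow> 0" if "f \<longlonglongrightarrow> 0" for f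
    using lin that by (simp add: linear_linear bounded_linear.tendsto_zero)
  text \<open>\<open>d\<close> is \<open>a\<^sup>2 - b b' = - K\<^sup>2 - 3 K\<^sup>4\<close> applied to the orbit, and eliminating \<open>z t\<close>
    between \<open>h t\<close> and \<open>h (Suc t)\<close> expresses it as \<open>a (h (Suc t)) + b' (K (h t))\<close>.\<close>
  define d where "d t = - K (K (z (Suc t))) - 3 *\<^sub>R K (K (K (K (z (Suc t)))))" for t
  have "d = (\<lambda>t. h (Suc t) + K (K (h (Suc t)))
      - K (h t) - 2 *\<^sub>R K (K (K (h t))) + K (K (h t)))"
  proof
    fix t
    have "3 *\<^sub>R x = x + x + x" "4 *\<^sub>R x = x + x + x + x" for x :: 'a
      using scaleR_add_left[of 1 2 x] scaleR_add_left[of 2 2 x] by (simp_all add: scaleR_2)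
    then show "d t = h (Suc t) + K (K (h (Suc t)))
      - K (h t) - 2 *\<^sub>R K (K (K (h t))) + K (K (h t))"
      unfolding d_def h_def g_def rec by (simp add: lin_simps scaleR_2 algebra_simps)
  qed
  moreover have "(\<lambda>t. h (Suc t) + K (K (h (Suc t)))
      - K (h t) - 2 *\<^sub>R K (K (K (h t))) + K (K (h t))) \<longlonglongrightarrow> 0 + 0 - 0 - 2 *\<^sub>R 0 + 0"
    by (intro tendsto_intros K0 LIMSEQ_Suc h0)
  ultimately have d0: "d \<longlonglongrightarrow> 0"
    by simp
  obtain c where c: "c > 0" "\<And>a. c * norm a \<le> norm (K a)"
    using linear_inj_bounded_below_pos[OF lin inj] by blast
  \<comment> \<open>Coercivity constant: \<open>inner (d t) (z (Suc t))\<close> is at least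
    \<open>e\<close> times the squared norm of \<open>z (Suc t)\<close>. Positivity of
    \<open>e\<close> is where injectivity of \<open>K\<close> and the strict bound on
    \<open>s\<close> enter.\<close>
  define e where "e = (1 - 3 * s\<^sup>2) * c\<^sup>2"
  have e: "e > 0"
    using c s by (simp add: e_def)
  have le: "norm (z (Suc t)) \<le> norm (d t) / e" for t
  proof -
    let ?a = "z (Suc t)"
    have "e * (norm ?a)\<^sup>2 \<le> (1 - 3 * s\<^sup>2) * (norm (K ?a))\<^sup>2"
      using power_mono[OF c(2)[of ?a], of 2] c(1) s
      by (simp add: e_def power_mult_distrib mult.assoc)
    also have "\<dots> \<le> (norm (K ?a))\<^sup>2 - 3 * (norm (K (K ?a)))\<^sup>2"
      using bound2[of "K ?a"] by (simp add: algebra_simps)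
    also have "\<dots> = inner (d t) ?a"
      unfolding d_def power2_norm_eq_inner by (simp add: inner_simps skew inner_commute)
    also have "\<dots> \<le> norm (d t) * norm ?a"
      by (rule norm_cauchy_schwarz)
    finally show ?thesis
      using e by (cases "?a = 0") (simp_all add: power2_eq_square field_simps)
  qed
  have "(\<lambda>t. z (Suc t)) \<longlonglongrightarrow> 0"
  proof (rule Lim_null_comparison)
    show "\<forall>\<^sub>F t in sequentially. norm (z (Suc t)) \<le> norm (d t) / e"
      using le by simp
    show "(\<lambda>t. norm (d t) / e) \<longlonglongrightarrow> 0"
      using tendsto_divide[OF tendsto_norm_zero[OF d0] tendsto_const[of e]] e by simp
  qed
  then show ?thesis
    by (rule LIMSEQ_imp_Suc)
qed

section \<open>The spectral norm as an attained operator norm\<close>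

declare transpose_matrix_vector [simp del]

text \<open>The adjoint rule keeps \<open>transpose A *v x\<close> intact, hence the removal of the
  simp rule that rewrites it to \<open>x v* A\<close>.\<close>

lemma inner_transpose_matrix_vector:
  fixes A :: "real^'n^'n"
  shows "inner (transpose A *v x) y = inner x (A *v y)"
  by (metis dot_lmul_matrix vector_transpose_matrix transpose_transpose)

lemma inner_gram:
  fixes A :: "real^'n^'n"
  shows "inner ((transpose A ** A) *v x) y = inner (A *v x) (A *v y)"
  by (simp add: inner_transpose_matrix_vector flip: matrix_vector_mul_assoc)

text \<open>Eigenvectors of a symmetric matrix for distinct eigenvalues are orthogonal, hence
  independent. Finiteness makes \<open>Max\<close> in \<open>spectral_norm\<close>
  meaningful.\<close>

lemma finite_gram_eigenvalues:
  fixes A :: "real^'n^'n"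
  shows "finite {l. matrix_eigenvalue (transpose A ** A) l}" (is "finite ?E")
proof -
  have "\<forall>l\<in>?E. \<exists>v. v \<noteq> 0 \<and> (transpose A ** A) *v v = l *\<^sub>R v"
    by (simp add: matrix_eigenvalue_def)
  from bchoice[OF this]
  obtain f where f: "\<And>l. l \<in> ?E \<Longrightarrow> f l \<noteq> 0 \<and> (transpose A ** A) *v f l = l *\<^sub>R f l"
    by blast
  have orth: "inner (f k) (f l) = 0" if "k \<in> ?E" "l \<in> ?E" "k \<noteq> l" for k l
  proof -
    have "k * inner (f k) (f l) = l * inner (f k) (f l)"
      using inner_gram[of A "f k" "f l"] inner_gram[of A "f l" "f k"] f that
      by (simp add: inner_commute)
    then show ?thesis
      using that by simp
  qed
  have "pairwise orthogonal (f ` ?E)"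
    unfolding pairwise_def orthogonal_def using orth by blast
  moreover have "0 \<notin> f ` ?E"
    using f by force
  ultimately have "finite (f ` ?E)"
    using pairwise_orthogonal_independent independent_imp_finite by blast
  moreover have "inj_on f ?E"
  proof (rule inj_onI, rule ccontr)
    fix k l assume kl: "k \<in> ?E" "l \<in> ?E" "f k = f l" "k \<noteq> l"
    then have "inner (f k) (f k) = 0"
      using orth[of k l] by simp
    then show False
      using f[OF kl(1)] by simp
  qed
  ultimately show ?thesis
    using finite_imageD by blast
qed

text \<open>Links the eigenvalue definition to the operator norm: a maximiser of
  \<open>norm (A *v w)\<close> on the unit sphere is an eigenvector of the Gram matrix, for its
  largest eigenvalue.\<close>

lemma spectral_norm_attained:
  fixes A :: "real^'n^'n"
  obtains v where "norm v = 1" "(transpose A ** A) *v v = (spectral_norm A)\<^sup>2 *\<^sub>R v"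
    "\<And>w. norm (A *v w) \<le> spectral_norm A * norm w"
    "spectral_norm A = norm (A *v v)"
proof -
  have "compact (sphere (0::real^'n) 1)" "sphere (0::real^'n) 1 \<noteq> {}"
    by (simp_all add: sphere_eq_empty)
  moreover have "continuous_on (sphere 0 1) (\<lambda>w. norm (A *v w))"
    by (intro continuous_intros)
  ultimately obtain v where v: "norm v = 1" "\<And>w. norm w = 1 \<Longrightarrow> norm (A *v w) \<le> norm (A *v v)"
    using continuous_attains_sup[of "sphere (0::real^'n) 1" "\<lambda>w. norm (A *v w)"] by auto
  define m where "m = norm (A *v v)"
  have le: "norm (A *v w) \<le> m * norm w" for w
  proof (cases "w = 0")
    case False
    then have "norm (A *v (w /\<^sub>R norm w)) \<le> m"
      unfolding m_def by (intro v) simp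
    then show ?thesis
      using False by (simp add: matrix_vector_mult_scaleR field_simps)
  qed simp
  define p where "p = m\<^sup>2 *\<^sub>R v - (transpose A ** A) *v v"
  text \<open>The nonnegative quadratic form \<open>m\<^sup>2 |w|\<^sup>2 - |A w|\<^sup>2\<close> vanishes at \<open>v\<close>, hence so does
    its gradient, which is \<open>2 p\<close>.\<close>
  have "inner p p = 0"
  proof (rule ccontr)
    assume "inner p p \<noteq> 0"
    define P where "P = inner p p"
    define Q where "Q = m\<^sup>2 * inner p p - inner (A *v p) (A *v p)"
    have P: "P > 0"
      using \<open>inner p p \<noteq> 0\<close> by (simp add: P_def)
    have quad: "0 \<le> t\<^sup>2 * Q + 2 * t * P" for t
    proof -
      have "(norm (A *v (v + t *\<^sub>R p)))\<^sup>2 \<le> m\<^sup>2 * (norm (v + t *\<^sub>R p))\<^sup>2"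
        using power_mono[OF le[of "v + t *\<^sub>R p"], of 2] by (simp add: power_mult_distrib)
      moreover have "m\<^sup>2 * inner v v = inner (A *v v) (A *v v)"
        using v(1) by (simp add: m_def flip: power2_norm_eq_inner)
      moreover have "P = m\<^sup>2 * inner v p - inner (A *v v) (A *v p)"
        unfolding P_def by (subst (1) p_def) (simp add: inner_diff_left inner_gram)
      moreover have "t * P + t * inner (A *v v) (A *v p) = t * (m\<^sup>2 * inner v p)"
        using calculation(3) by (simp flip: distrib_left)
      ultimately show ?thesis
        unfolding Q_def power2_norm_eq_inner
        by (simp add: matrix_vector_right_distrib matrix_vector_mult_scaleR inner_simps
            inner_commute algebra_simps power2_eq_square)
    qed
    \<comment> \<open>For small negative \<open>t\<close> the linear term would win:
      \<open>t = -1\<close> suffices if \<open>Q \<le> 0\<close>, otherwise the vertex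
      \<open>- (P / Q)\<close> of the parabola gives a negative value.\<close>
    show False
    proof (cases "Q \<le> 0")
      case True
      then show False using quad[of "-1"] P by simp
    next
      case False
      then have "(- (P / Q))\<^sup>2 * Q + 2 * (- (P / Q)) * P = - (P\<^sup>2 / Q)"
        by (simp add: field_simps power2_eq_square)
      then show False using quad[of "- (P / Q)"] P False
        by (simp add: divide_le_0_iff)
    qed
  qed
  then have eig: "(transpose A ** A) *v v = m\<^sup>2 *\<^sub>R v"
    by (simp add: p_def)
  have "Max {l. matrix_eigenvalue (transpose A ** A) l} = m\<^sup>2"
  proof (rule Max_eqI[OF finite_gram_eigenvalues])
    show "m\<^sup>2 \<in> {l. matrix_eigenvalue (transpose A ** A) l}"
      using eig v(1) unfolding matrix_eigenvalue_def by (auto intro!: exI[of _ v])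
    fix l assume "l \<in> {l. matrix_eigenvalue (transpose A ** A) l}"
    then obtain w where w: "w \<noteq> 0" "(transpose A ** A) *v w = l *\<^sub>R w"
      unfolding matrix_eigenvalue_def by blast
    have "l * (norm w)\<^sup>2 = (norm (A *v w))\<^sup>2"
      using inner_gram[of A w w] w by (simp add: power2_norm_eq_inner)
    also have "\<dots> \<le> m\<^sup>2 * (norm w)\<^sup>2"
      using power_mono[OF le[of w], of 2] by (simp add: power_mult_distrib)
    finally show "l \<le> m\<^sup>2"
      using w(1) by simp
  qed
  then have "spectral_norm A = m"
    by (simp add: spectral_norm_def m_def)
  then show thesis
    using that[of v] v(1) eig le m_def by metis
qed

lemma norm_transpose_le_spectral_norm:
  fixes A :: "real^'n^'n"
  shows "norm (transpose A *v x) \<le> spectral_norm A * norm x"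
proof -
  obtain v where le: "\<And>w. norm (A *v w) \<le> spectral_norm A * norm w"
    and v: "spectral_norm A = norm (A *v v)"
    using spectral_norm_attained by metis
  let ?b = "transpose A *v x"
  have "(norm ?b)\<^sup>2 = inner x (A *v ?b)"
    by (simp add: power2_norm_eq_inner inner_transpose_matrix_vector)
  also have "\<dots> \<le> norm x * norm (A *v ?b)"
    by (rule norm_cauchy_schwarz)
  also have "\<dots> \<le> norm x * (spectral_norm A * norm ?b)"
    by (intro mult_left_mono le) simp
  finally show ?thesis
    using v by (cases "?b = 0") (simp_all add: power2_eq_square mult.commute)
qed

lemma spectral_norm_pos:
  fixes A :: "real^'n^'n"
  assumes "invertible A"
  shows "0 < spectral_norm A"
proof -
  obtain v where v: "norm v = 1" "spectral_norm A = norm (A *v v)"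
    using spectral_norm_attained by metis
  have "A *v v \<noteq> 0"
    using v(1) assms by (metis invertible_def matrix_left_invertible_ker norm_zero zero_neq_one)
  then show ?thesis
    using v by simp
qed

section \<open>Convergence below the threshold\<close>

lemma ogda_converges_if_small:
  fixes A :: "real^'n^'n"
  assumes inv: "invertible A" and small: "\<bar>\<eta>\<bar> * spectral_norm A < 1 / sqrt 3"
  shows "ogda_converges A \<eta> x0 x1 y0 y1"
proof (cases "\<eta> = 0")
  \<comment> \<open>Here \<open>K\<close> would be zero, not injective, and the limit is
    \<open>(x1, y1)\<close> rather than 0.\<close>
  case True
  have "ogda_x A 0 x0 x1 y0 y1 (Suc t) = x1" "ogda_y A 0 x0 x1 y0 y1 (Suc t) = y1" for t
    by (induction t) simp_all
  then have "(\<lambda>t. ogda_x A 0 x0 x1 y0 y1 (Suc t)) \<longlonglongrightarrow> x1"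
    "(\<lambda>t. ogda_y A 0 x0 x1 y0 y1 (Suc t)) \<longlonglongrightarrow> y1"
    by simp_all
  then show ?thesis
    unfolding ogda_converges_def True by (auto intro: convergentI LIMSEQ_imp_Suc)
next
  case False
  let ?x = "ogda_x A \<eta> x0 x1 y0 y1" and ?y = "ogda_y A \<eta> x0 x1 y0 y1"
  define K :: "(real^'n) \<times> (real^'n) \<Rightarrow> (real^'n) \<times> (real^'n)"
    where "K p = (- (\<eta> *\<^sub>R (A *v snd p)), \<eta> *\<^sub>R (transpose A *v fst p))" for p
  let ?s = "\<bar>\<eta>\<bar> * spectral_norm A"
  obtain v where le: "\<And>w. norm (A *v w) \<le> spectral_norm A * norm w"
    using spectral_norm_attained by metis
  have s0: "0 \<le> ?s"
    using spectral_norm_pos[OF inv] by simp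
  have "(\<lambda>t. (?x t, ?y t)) \<longlonglongrightarrow> 0"
  proof (rule skew_recurrence_tendsto_0[of K ?s])
    show lin: "linear K"
      by (rule linearI)
        (simp_all add: K_def matrix_vector_right_distrib matrix_vector_mult_scaleR algebra_simps)
    show "inner (K a) b = - inner a (K b)" for a b
      by (simp add: K_def inner_prod_def inner_transpose_matrix_vector
          inner_commute[of _ "transpose A *v _"] inner_commute[of "A *v _"])
    have inj: "inj ((*v) A)" "inj ((*v) (transpose A))"
      using inv transpose_invertible[OF inv] by (simp_all add: inj_matrix_vector_mult)
    show "inj K"
    proof (rule injI)
      fix a b assume "K a = K b"
      then have "A *v snd a = A *v snd b" "transpose A *v fst a = transpose A *v fst b"
        using False by (simp_all add: K_def)
      then have "snd a = snd b" "fst a = fst b"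
        using inj by (simp_all add: inj_eq)
      then show "a = b"
        by (intro prod_eqI)
    qed
    show "norm (K a) \<le> ?s * norm a" for a
    proof -
      have "norm (snd (K a)) \<le> ?s * norm (fst a)" "norm (fst (K a)) \<le> ?s * norm (snd a)"
        using mult_left_mono[OF le[of "snd a"] abs_ge_zero[of \<eta>]]
          mult_left_mono[OF norm_transpose_le_spectral_norm[of A "fst a"] abs_ge_zero[of \<eta>]]
        by (simp_all add: K_def mult.assoc)
      then have "(norm (snd (K a)))\<^sup>2 \<le> ?s\<^sup>2 * (norm (fst a))\<^sup>2"
        "(norm (fst (K a)))\<^sup>2 \<le> ?s\<^sup>2 * (norm (snd a))\<^sup>2"
        unfolding power_mult_distrib[symmetric] by (simp_all only: power_mono norm_ge_zero)
      then have "(norm (fst (K a)))\<^sup>2 + (norm (snd (K a)))\<^sup>2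
          \<le> ?s\<^sup>2 * ((norm (fst a))\<^sup>2 + (norm (snd a))\<^sup>2)"
        unfolding distrib_left by linarith
      then have "(norm (K a))\<^sup>2 \<le> (?s * norm a)\<^sup>2"
        by (simp add: norm_prod_def power_mult_distrib)
      then show ?thesis
        by (rule power2_le_imp_le) (rule mult_nonneg_nonneg[OF s0 norm_ge_zero])
    qed
    show "0 \<le> ?s" by (fact s0)
    show "3 * ?s\<^sup>2 < 1"
      using power_strict_mono[OF small s0, of 2] by (simp add: power_divide)
    show "(?x (Suc (Suc t)), ?y (Suc (Suc t))) = (?x (Suc t), ?y (Suc t))
        + 2 *\<^sub>R K (?x (Suc t), ?y (Suc t)) - K (?x t, ?y t)" for t
      by (simp add: K_def)
  qed
  from tendsto_fst[OF this] tendsto_snd[OF this]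
  have "?x \<longlonglongrightarrow> 0" "?y \<longlonglongrightarrow> 0"
    by simp_all
  then show ?thesis
    unfolding ogda_converges_def by (blast intro: convergentI)
qed

section \<open>Instability from the threshold on\<close>

text \<open>Identifying \<open>(a u, b v)\<close> with \<open>a + \<i> b\<close> turns \<open>K\<close> into multiplication by \<open>\<i> \<eta> \<sigma>\<close>.\<close>

lemma ogda_singular_mode:
  fixes A :: "real^'n^'n"
  assumes Av: "A *v v = \<sigma> *\<^sub>R u" and Au: "transpose A *v u = \<sigma> *\<^sub>R v"
    and c: "c\<^sup>2 = (1 + 2 * \<i> * of_real (\<eta> * \<sigma>)) * c - \<i> * of_real (\<eta> * \<sigma>)"
  shows "ogda_x A \<eta> u (Re c *\<^sub>R u) 0 (Im c *\<^sub>R v) t = Re (c ^ t) *\<^sub>R u \<and>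
    ogda_y A \<eta> u (Re c *\<^sub>R u) 0 (Im c *\<^sub>R v) t = Im (c ^ t) *\<^sub>R v"
proof (induction t rule: less_induct)
  case (less t)
  consider "t = 0" | "t = Suc 0" | k where "t = Suc (Suc k)"
    by (metis not0_implies_Suc)
  then show ?case
  proof cases
    case 3
    have "c ^ t = c ^ k * c\<^sup>2"
      by (simp add: 3 power2_eq_square)
    also have "\<dots> = c ^ Suc k + \<i> * of_real (2 * \<eta> * \<sigma>) * c ^ Suc k - \<i> * of_real (\<eta> * \<sigma>) * c ^ k"
      unfolding c by (simp add: algebra_simps)
    finally have e: "c ^ t = \<dots>" .
    have "Re (c ^ t) = Re (c ^ Suc k) - 2 * \<eta> * \<sigma> * Im (c ^ Suc k) + \<eta> * \<sigma> * Im (c ^ k)"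
      "Im (c ^ t) = Im (c ^ Suc k) + 2 * \<eta> * \<sigma> * Re (c ^ Suc k) - \<eta> * \<sigma> * Re (c ^ k)"
      unfolding e by (simp_all add: algebra_simps del: power_Suc)
    then show ?thesis
      using less[of k] less[of "Suc k"]
      by (simp add: 3 Av Au matrix_vector_mult_scaleR scaleR_add_left scaleR_diff_left
          mult_ac del: power_Suc)
  qed simp_all
qed

text \<open>A limit is fixed under multiplication by \<open>c\<close>, hence 0, but the powers have
  norm at least 1.\<close>

lemma not_convergent_power:
  fixes c :: complex
  assumes "1 \<le> norm c" "c \<noteq> 1"
  shows "\<not> convergent (\<lambda>t. c ^ t)"
proof
  assume "convergent (\<lambda>t. c ^ t)"
  then obtain L where L: "(\<lambda>t. c ^ t) \<longlonglongrightarrow> L"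
    by (auto simp: convergent_def)
  have "(\<lambda>t. c ^ Suc t) \<longlonglongrightarrow> c * L"
    unfolding power_Suc by (intro tendsto_intros L)
  with LIMSEQ_Suc[OF L] have "c * L = L"
    using LIMSEQ_unique by blast
  then have "L = 0"
    using assms by simp
  moreover have "1 \<le> norm L"
    by (rule LIMSEQ_le_const[OF tendsto_norm[OF L]]) (auto simp: norm_power assms)
  ultimately show False
    by simp
qed

lemma unstable_root:
  fixes s :: real
  assumes "1 / sqrt 3 \<le> \<bar>s\<bar>"
  obtains c where "c\<^sup>2 = (1 + 2 * \<i> * of_real s) * c - \<i> * of_real s" "1 \<le> norm c" "c \<noteq> 1"
proof -
  define q where "q = sqrt (4 * s\<^sup>2 - 1)"
  have "1 / 3 \<le> s\<^sup>2"
    using power_mono[OF assms, of 2] by (simp add: power_divide)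
  then have q: "q\<^sup>2 = 4 * s\<^sup>2 - 1" "1 / sqrt 3 \<le> q"
    by (simp_all add: q_def real_le_rsqrt power_divide)
  \<comment> \<open>The discriminant \<open>1 - 4 * s\<^sup>2\<close> is negative, so both roots
    have real part 1/2. The factor \<open>sgn s\<close> selects the one of larger modulus,
    \<open>(1 + \<i> m) / 2\<close>, whose norm is at least 1 iff \<open>3 \<le> m\<^sup>2\<close>;
    at the threshold it lies on the unit circle.\<close>
  define m where "m = 2 * s + sgn s * q"
  have s: "s \<noteq> 0"
    using assms by auto
  have root: "m\<^sup>2 = 4 * s * m - 1"
  proof -
    have "(sgn s)\<^sup>2 = 1"
      using s by (simp add: sgn_real_def)
    then show ?thesis
      using q(1) unfolding m_def by (simp add: power2_sum power_mult_distrib algebra_simps power2_eq_square)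
  qed
  have "sqrt 3 = 3 / sqrt 3"
    by (simp add: real_div_sqrt)
  also have "\<dots> \<le> 2 * \<bar>s\<bar> + q"
    using assms q(2) by simp
  also have "\<dots> \<le> \<bar>m\<bar>"
    using s by (auto simp: m_def sgn_real_def)
  finally have m: "3 \<le> m\<^sup>2"
    using real_sqrt_le_iff[of 3 "m\<^sup>2"] by simp
  let ?c = "Complex (1 / 2) (m / 2)"
  show thesis
  proof
    show "?c\<^sup>2 = (1 + 2 * \<i> * of_real s) * ?c - \<i> * of_real s"
      using root by (simp add: complex_eq_iff power2_eq_square algebra_simps)
    show "1 \<le> norm ?c"
      using m by (simp add: cmod_def power_divide)
    show "?c \<noteq> 1"
      by (simp add: complex_eq_iff)
  qed
qed

lemma ogda_not_converges_if_large:
  fixes A :: "real^'n^'n"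
  assumes inv: "invertible A" and large: "1 / sqrt 3 \<le> \<bar>\<eta>\<bar> * spectral_norm A"
  shows "\<exists>x0 x1 y0 y1. \<not> ogda_converges A \<eta> x0 x1 y0 y1"
proof -
  let ?\<sigma> = "spectral_norm A"
  have pos: "0 < ?\<sigma>"
    by (rule spectral_norm_pos[OF inv])
  obtain v where v: "norm v = 1" "(transpose A ** A) *v v = ?\<sigma>\<^sup>2 *\<^sub>R v" "?\<sigma> = norm (A *v v)"
    using spectral_norm_attained by metis
  define u where "u = (A *v v) /\<^sub>R ?\<sigma>"
  have Av: "A *v v = ?\<sigma> *\<^sub>R u"
    using pos by (simp add: u_def)
  have Au: "transpose A *v u = ?\<sigma> *\<^sub>R v"
    using pos v(2) by (simp add: u_def matrix_vector_mult_scaleR matrix_vector_mul_assoc power2_eq_square)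
  have u: "norm u = 1"
    using pos v(3) by (simp add: u_def)
  obtain c where c: "c\<^sup>2 = (1 + 2 * \<i> * of_real (\<eta> * ?\<sigma>)) * c - \<i> * of_real (\<eta> * ?\<sigma>)"
    "1 \<le> norm c" "c \<noteq> 1"
    using unstable_root[of "\<eta> * ?\<sigma>"] large pos by (auto simp: abs_mult)
  note mode = ogda_singular_mode[OF Av Au c(1)]
  have "\<not> ogda_converges A \<eta> u (Re c *\<^sub>R u) 0 (Im c *\<^sub>R v)"
  proof
    assume "ogda_converges A \<eta> u (Re c *\<^sub>R u) 0 (Im c *\<^sub>R v)"
    then obtain X Y where "(\<lambda>t. Re (c ^ t) *\<^sub>R u) \<longlonglongrightarrow> X" "(\<lambda>t. Im (c ^ t) *\<^sub>R v) \<longlonglongrightarrow> Y"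
      unfolding ogda_converges_def convergent_def by (auto simp: mode[THEN conjunct1, abs_def] mode[THEN conjunct2, abs_def])
    \<comment> \<open>Pairing with the unit vectors \<open>u\<close> and \<open>v\<close> recovers
      the real and imaginary parts of \<open>c ^ t\<close>.\<close>
    then have "(\<lambda>t. inner (Re (c ^ t) *\<^sub>R u) u) \<longlonglongrightarrow> inner X u"
      "(\<lambda>t. inner (Im (c ^ t) *\<^sub>R v) v) \<longlonglongrightarrow> inner Y v"
      by (simp_all only: tendsto_inner tendsto_const)
    then have "(\<lambda>t. Complex (Re (c ^ t)) (Im (c ^ t))) \<longlonglongrightarrow> Complex (inner X u) (inner Y v)"
      using u v(1) by (intro tendsto_Complex) (simp_all flip: power2_norm_eq_inner)
    then show False
      using not_convergent_power[OF c(2,3)] by (auto simp: convergent_def)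
  qed
  then show ?thesis
    by blast
qed

theorem theorem3p1:
  fixes A :: "real^'n^'n" and \<eta> \<gamma> :: real
  assumes "invertible A"
    and "\<gamma> = spectral_norm A"
  shows "(\<bar>\<eta>\<bar> < 1 / (sqrt 3 * \<gamma>) \<longrightarrow> (\<forall>x0 x1 y0 y1. ogda_converges A \<eta> x0 x1 y0 y1)) \<and>
         (\<bar>\<eta>\<bar> \<ge> 1 / (sqrt 3 * \<gamma>) \<longrightarrow> (\<exists>x0 x1 y0 y1. \<not> ogda_converges A \<eta> x0 x1 y0 y1))"
proof -
  have "0 < \<gamma>"
    using spectral_norm_pos assms by simp
  then have "\<bar>\<eta>\<bar> < 1 / (sqrt 3 * \<gamma>) \<longleftrightarrow> \<bar>\<eta>\<bar> * \<gamma> < 1 / sqrt 3"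
    "1 / (sqrt 3 * \<gamma>) \<le> \<bar>\<eta>\<bar> \<longleftrightarrow> 1 / sqrt 3 \<le> \<bar>\<eta>\<bar> * \<gamma>"
    by (simp_all add: field_simps)
  then show ?thesis
    using ogda_converges_if_small[OF assms(1)] ogda_not_converges_if_large[OF assms(1)] assms(2)
    by blast
qed

end
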